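(* Let $n,k,t,q$ be integers with $q>2$, $n\ge k>t\ge 0$, $n\ge (t+1)(k-t+1)$ and $q\ge t+1$. Then $\mathcal F_q(t,k,n)$ is a maximum size $(t,k)_q$-intersecting family of words of length $n$; that is, it is a $(t,k)_q$-intersecting family of length $n$ and every $(t,k)_q$-intersecting family $\mathcal G$ of words of length $n$ satisfies $|\mathcal G|\le |\mathcal F_q(t,k,n)|$.
   Context: $\mathbb Z_q=\{0,1,\dots,q-1\}$ is the alphabet. The weight $\mathrm{wt}(x)$ of a word $x=(x_1,\dots,x_n)\in\mathbb Z_q^n$ is the number of indices $i$ with $x_i\ne 0$. A $(t,k)_q$-intersecting family (of length $n$) is a set of words of length $n$ and weight $k$ over $\mathbb Z_q$ such that for any two words $x,y$ in the set, $|\{i : 1\le i\le n,\ x_i=y_i \text{ and } x_i\neq 0\}|\ge t$. $\mathcal F_q(t,k,n)$ is the set of all words of length $n$ over $\mathbb Z_q$ of the form $(1,\dots,1,b_1,\dots,b_{n-t})$, starting with $t$ ones, where $b_i\in\mathbb Z_q$ and $\mathrm{wt}(b_1,\dots,b_{n-t})=k-t$. *)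

theory Defs
  imports Main
begin

text \<open>Words are lists of natural numbers; the coordinates 1, ..., n of a word of length n
  are the list positions 0, ..., n - 1.\<close>

definition words :: "nat \<Rightarrow> nat \<Rightarrow> nat list set" where
  "words q n = {x. length x = n \<and> set x \<subseteq> {0..<q}}"

definition wt :: "nat list \<Rightarrow> nat" where
  "wt x = card {i. i < length x \<and> x ! i \<noteq> 0}"

definition intersecting_family :: "nat \<Rightarrow> nat \<Rightarrow> nat \<Rightarrow> nat \<Rightarrow> nat list set \<Rightarrow> bool" where
  "intersecting_family q t k n G \<longleftrightarrow>
     G \<subseteq> {x \<in> words q n. wt x = k} \<and>
     (\<forall>x\<in>G. \<forall>y\<in>G. t \<le> card {i. i < n \<and> x ! i = y ! i \<and> x ! i \<noteq> 0})"

text \<open>The subtractions are the intended ones when \<open>t \<le> k\<close> and \<open>k \<le> n\<close>.\<close>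

definition star_family :: "nat \<Rightarrow> nat \<Rightarrow> nat \<Rightarrow> nat \<Rightarrow> nat list set" where
  "star_family q t k n =
     {replicate t 1 @ b | b. b \<in> words q (n - t) \<and> wt b = k - t}"

text \<open>By finiteness of the set of words, \<open>card\<close> is the true size of every
  intersecting family.\<close>

lemma finite_words: "finite (words q n)"
  using finite_lists_length_eq[of "{0..<q}" n]
  by (simp add: words_def conj_commute)

lemma finite_intersecting_family:
  "intersecting_family q t k n G \<Longrightarrow> finite G"
  unfolding intersecting_family_def
  using finite_subset[of G "words q n"] finite_words by blast

end

theory Submission
  imports Defs
begin

text \<open>
  The star consists of the words of weight \<open>k\<close> whose first \<open>t\<close> letters are ones. The idea is to
  turn an arbitrary intersecting family into a \<open>t\<close>-intersecting family of sets, weighted so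
  heavily towards small sets that the generating-set argument of Ahlswede and Khachatryan works
  with room to spare.

  Replacing a letter \<open>c \<ge> 2\<close> by \<open>1\<close> wherever this leads out of the family preserves size and
  intersection property. In a family closed under all these replacements, two words
  \<open>x\<close> and \<open>y\<close> already share \<open>t\<close> positions in which both have the letter \<open>1\<close>: replace by ones, in
  \<open>x\<close> only, all letters \<open>\<ge> 2\<close> that \<open>x\<close> and \<open>y\<close> have in common; the new word is still in the family, and it
  agrees with \<open>y\<close> only in common ones (\<open>exists_one_closed_family\<close>, \<open>ones_meet\<close>). So the sets
  of positions of ones are pairwise \<open>t\<close>-intersecting. The number of words of weight \<open>k\<close> whose ones
  are exactly the positions in \<open>S\<close> depends only on \<open>s = card S\<close>; it is
  \<open>w s = (n - s choose (k - s)) * (q - 2) ^ (k - s)\<close>. It remains to see that the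
  sets containing \<open>{..<t}\<close> have the greatest total weight (\<open>weighted_intersection_bound\<close>).

  Since \<open>q > 2\<close>, the quotient \<open>w s / w (s + 1) = (n - s) * (q - 2) / (k - s)\<close> is at least
  \<open>(n - s) / (k - s)\<close>, which exceeds \<open>t + 1\<close> for \<open>t \<le> s < k\<close> by the bound on \<open>n\<close>
  (\<open>fixed_ones_decay\<close>). Hence dropping one element from a set of more than \<open>t\<close>
  and at most \<open>k\<close> elements multiplies its weight by more than \<open>t + 1\<close>.

  Take a \<open>t\<close>-intersecting family of sets of greatest total weight and make it invariant under left
  shifts. Let \<open>m\<close> be the least position such that intersecting a member with \<open>{..m}\<close> always
  yields a member, and call a member containing \<open>m\<close> a boundary set if it leaves the family when
  \<open>m\<close> is dropped. Two boundary sets can have only \<open>t\<close> common elements in \<open>{..m}\<close> if their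
  union covers \<open>{..m}\<close>, but not otherwise; in that case the sizes of their traces on \<open>{..m}\<close>
  add up to \<open>m + 1 + t\<close>. If \<open>m \<ge> t\<close> and there were boundary sets, one could therefore drop \<open>m\<close>
  from suitably chosen ones and discard those that conflict with them, and the total weight
  would grow (\<open>exchange\<close>, \<open>boundary_empty\<close>). So there are none, against the choice of \<open>m\<close>.
  Hence already the intersections with \<open>{..<t}\<close> are members; having at least \<open>t\<close> elements,
  they equal \<open>{..<t}\<close>, and every member contains this set.
\<close>

section \<open>Compressing families\<close>

text \<open>
  Both the replacement of letters in words and the shifting of elements in sets are
  compressions: a map is applied to those members whose image is not yet in the family.
  Each effective step lowers the potential \<open>h\<close>, so the process ends. The condition
  \<open>cross\<close> handles the only delicate pair: if \<open>x\<close> is moved and \<open>y\<close> stays because \<open>f y\<close> is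
  already present, then \<open>f x\<close> meets \<open>y\<close> at least as much as \<open>x\<close> meets \<open>f y\<close>.
\<close>

lemma exists_compressed_family:
  fixes w h :: "'a \<Rightarrow> nat" and I :: "'a \<Rightarrow> 'a \<Rightarrow> nat"
  assumes "finite A" and "A \<subseteq> U" and "\<And>x y. x \<in> A \<Longrightarrow> y \<in> A \<Longrightarrow> t \<le> I x y"
    and closed: "\<And>f x. f \<in> F \<Longrightarrow> x \<in> U \<Longrightarrow> f x \<in> U"
    and inv: "\<And>f x. f \<in> F \<Longrightarrow> x \<in> U \<Longrightarrow> w (f x) = w x"
    and decr: "\<And>f x. f \<in> F \<Longrightarrow> x \<in> U \<Longrightarrow> f x \<noteq> x \<Longrightarrow> h (f x) < h x"
    and inj: "\<And>f x y. f \<in> F \<Longrightarrow> x \<in> U \<Longrightarrow> y \<in> U \<Longrightarrow> f x \<noteq> x \<Longrightarrow> f y \<noteq> y \<Longrightarrow>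
      f x = f y \<Longrightarrow> x = y"
    and sym: "\<And>x y. I x y = I y x"
    and mono: "\<And>f x y. f \<in> F \<Longrightarrow> x \<in> U \<Longrightarrow> y \<in> U \<Longrightarrow> I x y \<le> I (f x) (f y)"
    and cross: "\<And>f x y. f \<in> F \<Longrightarrow> x \<in> U \<Longrightarrow> y \<in> U \<Longrightarrow> f x \<noteq> x \<Longrightarrow> f y \<noteq> y \<Longrightarrow>
      I x (f y) \<le> I (f x) y"
  shows "\<exists>A'. finite A' \<and> A' \<subseteq> U \<and> (\<forall>x\<in>A'. \<forall>y\<in>A'. t \<le> I x y) \<and> sum w A' = sum w A \<and>
    (\<forall>f\<in>F. \<forall>x\<in>A'. f x \<in> A')"
  using assms(1-3)
proof (induction "sum h A" arbitrary: A rule: less_induct)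
  case less
  show ?case
  proof (cases "\<forall>f\<in>F. \<forall>x\<in>A. f x \<in> A")
    case True
    with less.prems show ?thesis by blast
  next
    case False
    then obtain f z where f: "f \<in> F" and z: "z \<in> A" "f z \<notin> A" by blast
    define D where "D = {x \<in> A. f x \<notin> A}"
    define A' where "A' = (A - D) \<union> f ` D"
    have D: "D \<subseteq> A" "finite D" "z \<in> D"
      using less.prems(1) z by (auto simp: D_def)
    have moved: "f x \<noteq> x" if "x \<in> D" for x
      using that by (auto simp: D_def)
    have inU: "x \<in> U" if "x \<in> A" for x
      using that less.prems(2) by blast
    have injD: "inj_on f D"
      by (intro inj_onI) (metis D(1) f inU inj moved subsetD)
    have sumA': "sum g A' = sum g (A - D) + sum (g \<circ> f) D" for g :: "'a \<Rightarrow> nat"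
    proof -
      have "sum g A' = sum g (A - D) + sum g (f ` D)"
        unfolding A'_def using less.prems(1) D(2)
        by (intro sum.union_disjoint) (auto simp: D_def)
      then show ?thesis by (simp add: sum.reindex[OF injD])
    qed
    have sumA: "sum g A = sum g (A - D) + sum g D" for g :: "'a \<Rightarrow> nat"
      using less.prems(1) D(1) by (simp add: sum.subset_diff)
    have "sum (w \<circ> f) D = sum w D"
      using D(1) f inU inv by (intro sum.cong) auto
    then have w_eq: "sum w A' = sum w A"
      by (simp add: sumA sumA')
    have "sum (h \<circ> f) D < sum h D"
      using D f inU moved decr by (intro sum_strict_mono) auto
    then have h_less: "sum h A' < sum h A"
      by (simp add: sumA sumA')
    have shifted_unshifted: "t \<le> I (f x) y" if "x \<in> D" "y \<in> A - D" for x y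
    proof -
      have xy: "x \<in> A" "y \<in> A" "f y \<in> A"
        using that by (auto simp: D_def)
      show ?thesis
      proof (cases "f y = y")
        case True
        then show ?thesis
          using mono[OF f, of x y] inU xy less.prems(3)[of x y] by fastforce
      next
        case False
        then show ?thesis
          using cross[OF f, of x y] inU xy moved[OF that(1)] less.prems(3)[of x "f y"] by fastforce
      qed
    qed
    have both: "t \<le> I (f x) (f y)" if "x \<in> D" "y \<in> D" for x y
      using mono[OF f, of x y] that D(1) inU less.prems(3)[of x y] by fastforce
    have int: "t \<le> I x y" if "x \<in> A'" "y \<in> A'" for x y
      using that less.prems(3)[of x y] both shifted_unshifted sym
      by (auto simp: A'_def)
    have "finite A'" "A' \<subseteq> U"
      using less.prems D inU closed f by (auto simp: A'_def)
    from less.hyps[OF h_less this int] w_eq show ?thesis by simp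
  qed
qed

section \<open>A weighted intersection theorem for families of sets\<close>

definition intersecting_sets :: "nat \<Rightarrow> nat \<Rightarrow> nat \<Rightarrow> nat set set \<Rightarrow> bool" where
  "intersecting_sets t k n A \<longleftrightarrow>
     (\<forall>S\<in>A. S \<subseteq> {..<n} \<and> card S \<le> k) \<and> (\<forall>S\<in>A. \<forall>T\<in>A. t \<le> card (S \<inter> T))"

lemma intersecting_sets_finite: "intersecting_sets t k n A \<Longrightarrow> finite A"
  by (rule finite_subset[of _ "Pow {..<n}"]) (auto simp: intersecting_sets_def)

definition shift :: "nat \<Rightarrow> nat \<Rightarrow> nat set \<Rightarrow> nat set" where
  "shift i j S = (if j \<in> S \<and> i \<notin> S then insert i (S - {j}) else S)"

lemma card_shift: "finite S \<Longrightarrow> card (shift i j S) = card S"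
  using card_Suc_Diff1[of S j]
  by (auto simp: shift_def card_insert_if simp del: card_Diff_singleton)

lemma exists_shifted_family:
  fixes w :: "nat \<Rightarrow> nat"
  assumes "intersecting_sets t k n A"
  obtains A' where "intersecting_sets t k n A'"
    and "(\<Sum>S\<in>A'. w (card S)) = (\<Sum>S\<in>A. w (card S))"
    and "\<And>i j S. i < j \<Longrightarrow> S \<in> A' \<Longrightarrow> j \<in> S \<Longrightarrow> i \<notin> S \<Longrightarrow> insert i (S - {j}) \<in> A'"
proof -
  let ?U = "{S. S \<subseteq> {..<n} \<and> card S \<le> k}"
  let ?F = "{shift i j | i j. i < j \<and> j < n}"
  have fin: "finite S" if "S \<in> ?U" for S
    using that finite_subset by blast
  have "\<exists>A'. finite A' \<and> A' \<subseteq> ?U \<and> (\<forall>x\<in>A'. \<forall>y\<in>A'. t \<le> card (x \<inter> y)) \<and>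
      (\<Sum>S\<in>A'. w (card S)) = (\<Sum>S\<in>A. w (card S)) \<and> (\<forall>f\<in>?F. \<forall>x\<in>A'. f x \<in> A')"
  proof (rule exists_compressed_family[where h = "\<lambda>S. \<Sum>S" and I = "\<lambda>S T. card (S \<inter> T)"])
    show "finite A" using assms by (rule intersecting_sets_finite)
    show "A \<subseteq> ?U" and "\<And>x y. x \<in> A \<Longrightarrow> y \<in> A \<Longrightarrow> t \<le> card (x \<inter> y)"
      using assms by (auto simp: intersecting_sets_def)
    fix f S assume f: "f \<in> ?F" and S: "S \<in> ?U"
    from f obtain i j where ij: "f = shift i j" "i < j" "j < n" by blast
    show "f S \<in> ?U"
      using S fin[OF S] ij by (auto simp: card_shift) (auto simp: shift_def split: if_splits)
    show "w (card (f S)) = w (card S)"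
      using fin[OF S] ij by (simp add: card_shift)
    show "\<Sum>(f S) < \<Sum>S" if "f S \<noteq> S"
    proof -
      have m: "j \<in> S" "i \<notin> S" and fS: "f S = insert i (S - {j})"
        using that ij by (auto simp: shift_def split: if_splits)
      have "\<Sum>S = j + \<Sum>(S - {j})" using fin[OF S] m by (simp add: sum.remove)
      then show ?thesis unfolding fS using fin[OF S] m ij by simp
    qed
    fix T assume T: "T \<in> ?U"
    have finST: "finite (S \<inter> T)" using fin[OF S] by simp
    show "S = T" if "f S \<noteq> S" "f T \<noteq> T" "f S = f T"
    proof -
      have "S = insert j (f S - {i})" "T = insert j (f T - {i})"
        using that(1,2) ij by (auto simp: shift_def split: if_splits)
      with that(3) show ?thesis by simp
    qed
    have swap: "card (insert i (S \<inter> T - {j})) = card (S \<inter> T)" if "j \<in> S \<inter> T" "i \<notin> S \<inter> T"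
      using that finST card_Suc_Diff1[of "S \<inter> T" j]
      by (auto simp: card_insert_if simp del: card_Diff_singleton)
    show "card (S \<inter> T) \<le> card (f S \<inter> f T)"
    proof (cases "j \<in> S \<inter> T \<and> i \<notin> S \<inter> T")
      case True
      then have "f S \<inter> f T = insert i (S \<inter> T - {j})"
        using ij by (auto simp: shift_def)
      with swap True show ?thesis by simp
    next
      case False
      then have "S \<inter> T \<subseteq> f S \<inter> f T"
        using ij by (auto simp: shift_def)
      then show ?thesis
        using fin[OF S] ij by (intro card_mono) (auto simp: shift_def)
    qed
    show "card (S \<inter> f T) \<le> card (f S \<inter> T)" if "f S \<noteq> S" "f T \<noteq> T"
    proof -
      have "S \<inter> f T = f S \<inter> T"
        using that ij by (auto simp: shift_def split: if_splits)
      then show ?thesis by simp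
    qed
  qed (simp add: Int_commute)
  then obtain A' where A': "A' \<subseteq> ?U" "\<forall>x\<in>A'. \<forall>y\<in>A'. t \<le> card (x \<inter> y)"
      "(\<Sum>S\<in>A'. w (card S)) = (\<Sum>S\<in>A. w (card S))" "\<forall>f\<in>?F. \<forall>x\<in>A'. f x \<in> A'" by blast
  show ?thesis
  proof (rule that[OF _ A'(3)])
    show "intersecting_sets t k n A'"
      using A'(1,2) by (auto simp: intersecting_sets_def)
    fix i j S assume *: "i < j" "S \<in> A'" "j \<in> S" "i \<notin> S"
    then have "j < n" using A'(1) by auto
    then have "shift i j S \<in> A'" using A'(4) * by blast
    then show "insert i (S - {j}) \<in> A'" using * by (simp add: shift_def)
  qed
qed

text \<open>
  A shifted family of greatest weight, together with a position \<open>m \<ge> t\<close> such that cutting off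
  its members after \<open>m\<close> yields members. Minimality of \<open>m\<close> is not part of the assumptions;
  the aim is to show that \<open>m\<close> can always be lowered.
\<close>

locale extremal_family =
  fixes t k n :: nat and w :: "nat \<Rightarrow> nat" and A :: "nat set set" and m :: nat
  assumes decay: "t \<le> s \<Longrightarrow> s < k \<Longrightarrow> (t + 1) * w (Suc s) < w s"
    and intersecting: "intersecting_sets t k n A"
    and maximal: "intersecting_sets t k n A' \<Longrightarrow>
      (\<Sum>S\<in>A'. w (card S)) \<le> (\<Sum>S\<in>A. w (card S))"
    and shifted: "i < j \<Longrightarrow> S \<in> A \<Longrightarrow> j \<in> S \<Longrightarrow> i \<notin> S \<Longrightarrow> insert i (S - {j}) \<in> A"
    and trace: "S \<in> A \<Longrightarrow> S \<inter> {..m} \<in> A"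
    and m_ge: "t \<le> m"
begin

text \<open>
  These are the members for which the element \<open>m\<close> is indispensable. Without them
  one could replace \<open>{..m}\<close> by \<open>{..<m}\<close> in the assumption \<open>trace\<close>.
\<close>

definition boundary :: "nat set set" where
  "boundary = {S \<in> A. m \<in> S \<and> S - {m} \<notin> A}"

abbreviation weight :: "nat set set \<Rightarrow> nat" where
  "weight X \<equiv> (\<Sum>S\<in>X. w (card S))"

abbreviation level :: "nat set \<Rightarrow> nat" where
  "level S \<equiv> card (S \<inter> {..m})"

lemma meet: "S \<in> A \<Longrightarrow> T \<in> A \<Longrightarrow> t \<le> card (S \<inter> T)"
  using intersecting by (simp add: intersecting_sets_def)

lemma member: "S \<in> A \<Longrightarrow> S \<subseteq> {..<n} \<and> card S \<le> k \<and> finite S"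
  using intersecting finite_subset by (auto simp: intersecting_sets_def)

lemma boundaryD: "S \<in> boundary \<Longrightarrow> S \<in> A \<and> m \<in> S \<and> S - {m} \<notin> A"
  by (simp add: boundary_def)

lemma finite_boundary: "finite boundary"
  using intersecting_sets_finite[OF intersecting] by (simp add: boundary_def)

text \<open>
  If \<open>i\<close> is missing from both sets, then trading \<open>m\<close> for \<open>i\<close> in the trace of \<open>S\<close> on \<open>{..m}\<close> stays inside the
  shifted family and costs exactly one common element with \<open>T\<close>.
\<close>

lemma boundary_meet_strict:
  assumes "S \<in> boundary" "T \<in> boundary" "i \<le> m" "i \<notin> S" "i \<notin> T"
  shows "t < card (S \<inter> T \<inter> {..m})"
proof -
  have "insert i (S \<inter> {..m} - {m}) \<in> A"
    using assms boundaryD by (intro shifted trace) (auto simp: nat_less_le)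
  then have "t \<le> card (insert i (S \<inter> {..m} - {m}) \<inter> T)"
    using assms(2) boundaryD meet by blast
  also have "insert i (S \<inter> {..m} - {m}) \<inter> T = S \<inter> T \<inter> {..m} - {m}"
    using assms(5) by auto
  also have "card \<dots> < card (S \<inter> T \<inter> {..m})"
    using assms(1,2) boundaryD by (intro card_Diff1_less) auto
  finally show ?thesis .
qed

text \<open>
  An intersection of size \<open>t\<close> is possible only when the two traces cover \<open>{..m}\<close>, and then
  inclusion and exclusion determines the sum of their sizes.
\<close>

lemma boundary_meet_unbalanced:
  assumes "S \<in> boundary" "T \<in> boundary" "level S + level T \<noteq> m + 1 + t"
  shows "t < card (S \<inter> T \<inter> {..m})"
proof (cases "{..m} \<subseteq> S \<union> T")
  case True
  then have "S \<inter> {..m} \<union> T \<inter> {..m} = {..m}" by blast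
  moreover have "S \<inter> {..m} \<inter> (T \<inter> {..m}) = S \<inter> T \<inter> {..m}" by blast
  ultimately have "level S + level T = m + 1 + card (S \<inter> T \<inter> {..m})"
    using card_Un_Int[of "S \<inter> {..m}" "T \<inter> {..m}"] by simp
  moreover have "t \<le> card (S \<inter> {..m} \<inter> T)"
    using assms(1,2) boundaryD meet trace by blast
  then have "t \<le> card (S \<inter> T \<inter> {..m})" by (simp add: Int_ac)
  ultimately show ?thesis using assms(3) by linarith
next
  case False
  then show ?thesis using boundary_meet_strict[OF assms(1,2)] by auto
qed

text \<open>
  A boundary set with only \<open>t\<close> elements in \<open>{..m}\<close> would, paired with itself, have to cover
  \<open>{..m}\<close>, which has more than \<open>t\<close> elements. This puts boundary sets in the range where the
  weight decays.
\<close>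

lemma boundary_card: assumes "S \<in> boundary" shows "t < card S"
proof -
  have "t < level S"
    using boundary_meet_unbalanced[OF assms assms] m_ge by (cases "2 * level S = m + 1 + t") auto
  also have "level S \<le> card S"
    using assms boundaryD member by (intro card_mono) auto
  finally show ?thesis .
qed

text \<open>
  Discard \<open>R\<close> and add the sets of \<open>C\<close> with \<open>m\<close> dropped. Members outside the boundary cause no conflict: if
  such a \<open>T\<close> contains \<open>m\<close>, then \<open>T\<close> without \<open>m\<close> is a member too and meets \<open>S\<close> in \<open>t\<close> elements other than \<open>m\<close>.
  So only boundary sets that are kept need to meet \<open>C\<close> in more than \<open>t\<close> elements. By maximality
  the weight gained, more than \<open>t + 1\<close> times that of \<open>C\<close>, cannot exceed the weight lost.
\<close>

lemma exchange:
  assumes R: "R \<subseteq> boundary" and C: "C \<subseteq> boundary - R" "C \<noteq> {}"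
    and big: "\<And>S T. S \<in> C \<Longrightarrow> T \<in> boundary - R \<Longrightarrow> t < card (S \<inter> T)"
  shows "(t + 1) * weight C < weight R"
proof -
  let ?d = "\<lambda>S. S - {m}"
  define A' where "A' = (A - R) \<union> ?d ` C"
  have finA: "finite A" using intersecting by (rule intersecting_sets_finite)
  have RA: "R \<subseteq> A" and CA: "C \<subseteq> A" using R C by (auto simp: boundary_def)
  have fin: "finite R" "finite C" using RA CA finA finite_subset by blast+
  have m_in: "m \<in> S" if "S \<in> C" for S using that C boundaryD by blast
  have card_d: "t \<le> card (?d S \<inter> T)" if "S \<in> C" "T \<in> A - R" for S T
  proof (cases "T \<in> boundary")
    case True
    then have "t < card (S \<inter> T)" using big that by blast
    also have "S \<inter> T - {m} = ?d S \<inter> T" by blast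
    then have "card (S \<inter> T) \<le> Suc (card (?d S \<inter> T))"
      using card_Diff_singleton_if[of "S \<inter> T" m] by (auto split: if_splits)
    finally show ?thesis by simp
  next
    case False
    then have T: "m \<notin> T \<or> ?d T \<in> A" using that by (auto simp: boundary_def)
    then have "t \<le> card (S \<inter> ?d T)"
      using that CA meet[of S T] meet[of S "?d T"] by (auto simp: Diff_insert0)
    also have "S \<inter> ?d T = ?d S \<inter> T" by blast
    finally show ?thesis .
  qed
  have card_dd: "t \<le> card (?d S \<inter> ?d T)" if "S \<in> C" "T \<in> C" for S T
  proof -
    have "t < card (S \<inter> T)" using big that C by blast
    moreover have "?d S \<inter> ?d T = S \<inter> T - {m}" by blast
    moreover have "m \<in> S \<inter> T" using m_in that by blast
    moreover have "finite (S \<inter> T)" using member CA that by blast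
    ultimately show ?thesis by (simp add: card_Diff_singleton)
  qed
  have "intersecting_sets t k n A'"
    unfolding intersecting_sets_def
  proof (intro conjI ballI)
    fix S assume "S \<in> A'"
    then obtain S' where S': "S' \<in> A" "S \<subseteq> S'" using CA by (auto simp: A'_def)
    then have "card S \<le> card S'" using member by (intro card_mono) auto
    then show "S \<subseteq> {..<n}" "card S \<le> k" using S' member by fastforce+
  next
    fix S T assume "S \<in> A'" "T \<in> A'"
    then show "t \<le> card (S \<inter> T)"
      using card_d card_dd meet by (auto simp: A'_def) (metis Int_commute)
  qed
  then have "weight A' \<le> weight A" by (rule maximal)
  moreover have "weight A' = weight (A - R) + (\<Sum>S\<in>C. w (card (?d S)))"
  proof -
    have "weight A' = weight (A - R) + weight (?d ` C)"
      unfolding A'_def using finA fin C boundaryD by (intro sum.union_disjoint) auto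
    moreover have "inj_on ?d C"
      by (intro inj_onI) (metis insert_Diff m_in)
    ultimately show ?thesis by (simp add: sum.reindex)
  qed
  moreover have "weight A = weight (A - R) + weight R"
    using finA RA by (simp add: sum.subset_diff)
  moreover have "(t + 1) * weight C < (\<Sum>S\<in>C. w (card (?d S)))"
  proof -
    have "(t + 1) * w (card S) < w (card (?d S))" if "S \<in> C" for S
    proof -
      have S: "t < card S" "card S \<le> k" "finite S" "m \<in> S"
        using that C boundary_card member CA m_in by auto
      then have "card S = Suc (card (?d S))" by (simp add: card_Suc_Diff1)
      then show ?thesis using decay[of "card (?d S)"] S by simp
    qed
    then show ?thesis
      unfolding sum_distrib_left using fin C(2) by (intro sum_strict_mono) auto
  qed
  ultimately show ?thesis by linarith
qed

text \<open>
  Call a boundary set large or small according to whether its trace has more or fewer than half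
  of \<open>m + 1 + t\<close> elements. A small set conflicts only with large ones and vice versa, so either
  kind can be discarded in favour of the other. Each kind would therefore have to be
  heavier than the other, unless neither occurs.
\<close>

lemma boundary_balanced:
  assumes "S \<in> boundary" shows "2 * level S = m + 1 + t"
proof -
  define L where "L = {S \<in> boundary. m + 1 + t < 2 * level S}"
  define M where "M = {S \<in> boundary. 2 * level S < m + 1 + t}"
  have big: "t < card (S \<inter> T)"
    if "S \<in> boundary" "T \<in> boundary" "level S + level T \<noteq> m + 1 + t" for S T
  proof -
    have "t < card (S \<inter> T \<inter> {..m})" using boundary_meet_unbalanced that by blast
    also have "\<dots> \<le> card (S \<inter> T)"
      using that(1) boundaryD member by (intro card_mono) auto
    finally show ?thesis .
  qed
  have "(t + 1) * weight M < weight L" if "M \<noteq> {}"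
    by (rule exchange) (use that in \<open>auto simp: L_def M_def intro!: big\<close>)
  moreover have "(t + 1) * weight L < weight M" if "L \<noteq> {}"
    by (rule exchange) (use that in \<open>auto simp: L_def M_def intro!: big\<close>)
  ultimately have "L = {} \<and> M = {}"
    by (cases "L = {}"; cases "M = {}") auto
  then show ?thesis using assms unfolding L_def M_def by (fastforce simp: not_less)
qed

text \<open>
  All boundary sets now have traces of the same size, and two of them that both miss some
  \<open>i < m\<close> meet in more than \<open>t\<close> elements. Hence one may keep those that miss \<open>i\<close>, also add them
  without \<open>m\<close>, and discard the others; by maximality those that miss \<open>i\<close> carry less than
  a fraction \<open>1 / (t + 2)\<close> of the boundary weight. But each boundary set misses \<open>d\<close> of
  the \<open>m = 2 * d + t - 1\<close> candidates \<open>i\<close>, which is more than this fraction; so averaging over \<open>i\<close> gives a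
  contradiction.
\<close>

lemma boundary_empty: "boundary = {}"
proof (rule ccontr)
  assume "boundary \<noteq> {}"
  then obtain S0 where S0: "S0 \<in> boundary" by blast
  define C where "C i = {S \<in> boundary. i \<notin> S}" for i
  define d where "d = m + 1 - level S0"
  have missing: "card {i \<in> {..<m}. i \<notin> S} = d" if "S \<in> boundary" for S
  proof -
    have "{i \<in> {..<m}. i \<notin> S} = {..m} - S \<inter> {..m}"
      using that boundaryD by (auto simp: nat_less_le)
    then have "card {i \<in> {..<m}. i \<notin> S} = m + 1 - level S"
      by (simp add: card_Diff_subset)
    moreover have "level S = level S0"
      using boundary_balanced[OF that] boundary_balanced[OF S0] by simp
    ultimately show ?thesis by (simp add: d_def)
  qed
  have m_eq: "m + 1 = 2 * d + t" and d_pos: "0 < d"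
    using boundary_balanced[OF S0] m_ge by (auto simp: d_def)
  have gain: "(t + 2) * weight (C i) < weight boundary" if "i < m" "C i \<noteq> {}" for i
  proof -
    have "(t + 1) * weight (C i) < weight (boundary - C i)"
    proof (rule exchange)
      fix S T assume "S \<in> C i" "T \<in> boundary - (boundary - C i)"
      then have ST: "S \<in> boundary" "T \<in> boundary" "i \<notin> S" "i \<notin> T" by (auto simp: C_def)
      then have "t < card (S \<inter> T \<inter> {..m})" using that(1) by (intro boundary_meet_strict) auto
      also have "\<dots> \<le> card (S \<inter> T)"
        using ST(1) boundaryD member by (intro card_mono) auto
      finally show "t < card (S \<inter> T)" .
    qed (use that in \<open>auto simp: C_def\<close>)
    moreover have "weight boundary = weight (boundary - C i) + weight (C i)"
      using finite_boundary by (intro sum.subset_diff) (auto simp: C_def)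
    ultimately show ?thesis by simp
  qed
  have "{i \<in> {..<m}. i \<notin> S0} \<noteq> {}"
    using missing[OF S0] d_pos by (metis card.empty less_irrefl)
  then obtain i0 where "i0 < m" "i0 \<notin> S0" by blast
  then have "i0 < m" "C i0 \<noteq> {}" using S0 by (auto simp: C_def)
  then have pos: "0 < weight boundary" using gain[of i0] by linarith
  \<comment> \<open>Count the pairs of a boundary set and a position that it misses, by weight, in two ways.\<close>
  have "(\<Sum>i<m. weight (C i)) = (\<Sum>i<m. \<Sum>S\<in>boundary. if i \<notin> S then w (card S) else 0)"
    using finite_boundary by (simp add: C_def sum.inter_filter)
  also have "\<dots> = (\<Sum>S\<in>boundary. \<Sum>i<m. if i \<notin> S then w (card S) else 0)"
    by (rule sum.swap)
  also have "\<dots> = (\<Sum>S\<in>boundary. \<Sum>i\<in>{i \<in> {..<m}. i \<notin> S}. w (card S))"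
    by (intro sum.cong refl sum.inter_filter[symmetric]) simp
  also have "\<dots> = d * weight boundary"
    using missing by (simp add: sum_distrib_left)
  finally have count: "(\<Sum>i<m. weight (C i)) = d * weight boundary" .
  have "(t + 2) * weight (C i) \<le> weight boundary" if "i < m" for i
    using gain[OF that] by (cases "C i = {}") auto
  then have "(\<Sum>i<m. (t + 2) * weight (C i)) \<le> (\<Sum>i<m. weight boundary)"
    by (intro sum_mono) auto
  then have "(t + 2) * d * weight boundary \<le> m * weight boundary"
    by (simp add: sum_distrib_left[symmetric] count mult.assoc del: add_2_eq_Suc')
  then have "(t + 2) * d \<le> m" using pos by simp
  moreover have "t + 2 * d \<le> (t + 2) * d" using d_pos by (cases d) auto
  ultimately show False using m_eq by linarith
qed

end

text \<open>
  The exchange argument applies to a shifted family of greatest weight, which may differ from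
  \<open>A\<close>. Cutting off its members after the first \<open>t\<close> positions yields members, and these meet
  themselves in at least \<open>t\<close> elements; so all its members contain \<open>{..<t}\<close>.
\<close>

theorem weighted_intersection_bound:
  fixes w :: "nat \<Rightarrow> nat"
  assumes decay: "\<And>s. t \<le> s \<Longrightarrow> s < k \<Longrightarrow> (t + 1) * w (Suc s) < w s"
    and A: "intersecting_sets t k n A"
  shows "(\<Sum>S\<in>A. w (card S)) \<le>
    (\<Sum>S | {..<t} \<subseteq> S \<and> S \<subseteq> {..<n} \<and> card S \<le> k. w (card S))"
proof -
  let ?W = "\<lambda>A. \<Sum>S\<in>A. w (card S)"
  have "{A. intersecting_sets t k n A} \<subseteq> Pow (Pow {..<n})"
    by (auto simp: intersecting_sets_def)
  then have "finite {A. intersecting_sets t k n A}"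
    by (rule finite_subset) simp
  then obtain A1 where A1: "intersecting_sets t k n A1"
    and max1: "\<And>A. intersecting_sets t k n A \<Longrightarrow> ?W A \<le> ?W A1"
    using A obtains_MAX[of "{A. intersecting_sets t k n A}" ?W] Max_ge
    by (metis (mono_tags, lifting) empty_iff finite_imageI imageI mem_Collect_eq)
  obtain A2 where A2: "intersecting_sets t k n A2" and W2: "?W A2 = ?W A1"
    and shifted: "\<And>i j S. i < j \<Longrightarrow> S \<in> A2 \<Longrightarrow> j \<in> S \<Longrightarrow> i \<notin> S \<Longrightarrow> insert i (S - {j}) \<in> A2"
    using exists_shifted_family[OF A1, of w] by blast
  have max2: "?W A \<le> ?W A2" if "intersecting_sets t k n A" for A
    using max1 that W2 by simp
  \<comment> \<open>The bound \<open>l\<close> is exclusive so that it can be \<open>0\<close> when no position is needed.\<close>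
  define l where "l = (LEAST l. \<forall>S\<in>A2. S \<inter> {..<l} \<in> A2)"
  have "S \<inter> {..<n} = S" if "S \<in> A2" for S
    using A2 that by (auto simp: intersecting_sets_def)
  then have "\<forall>S\<in>A2. S \<inter> {..<n} \<in> A2" by simp
  then have l: "\<forall>S\<in>A2. S \<inter> {..<l} \<in> A2"
    unfolding l_def by (rule LeastI)
  have "l \<le> t"
  proof (rule ccontr)
    assume "\<not> l \<le> t"
    then obtain m where m: "l = Suc m" "t \<le> m" by (cases l) auto
    interpret extremal_family t k n w A2 m
      using decay A2 max2 shifted l m by unfold_locales (auto simp: lessThan_Suc_atMost)
    have "\<not> (\<forall>S\<in>A2. S \<inter> {..<m} \<in> A2)"
      using m(1) not_less_Least[of m "\<lambda>l. \<forall>S\<in>A2. S \<inter> {..<l} \<in> A2"] by (simp add: l_def)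
    then obtain S where S: "S \<in> A2" "S \<inter> {..<m} \<notin> A2" by blast
    \<comment> \<open>The trace of \<open>S\<close> on \<open>{..m}\<close> is a member, that on \<open>{..<m}\<close> is not: a boundary set.\<close>
    have SA: "S \<inter> {..m} \<in> A2" using S(1) by (rule trace)
    have eq: "S \<inter> {..m} - {m} = S \<inter> {..<m}" by auto
    have "m \<in> S \<inter> {..m}" using SA S(2) eq by (metis Diff_insert0 Diff_empty)
    then have "S \<inter> {..m} \<in> boundary" using SA S(2) eq by (simp add: boundary_def)
    then show False using boundary_empty by simp
  qed
  have "{..<t} \<subseteq> S" if "S \<in> A2" for S
  proof -
    have "t \<le> card (S \<inter> {..<l} \<inter> (S \<inter> {..<l}))"
      using A2 l that unfolding intersecting_sets_def by blast
    also have "\<dots> \<le> card (S \<inter> {..<t})"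
      using \<open>l \<le> t\<close> by (intro card_mono) auto
    finally have "S \<inter> {..<t} = {..<t}"
      by (intro card_seteq) auto
    then show ?thesis by blast
  qed
  then have "A2 \<subseteq> {S. {..<t} \<subseteq> S \<and> S \<subseteq> {..<n} \<and> card S \<le> k}"
    using A2 by (auto simp: intersecting_sets_def)
  moreover have "finite {S. {..<t} \<subseteq> S \<and> S \<subseteq> {..<n} \<and> card S \<le> k}"
    by (rule finite_subset[of _ "Pow {..<n}"]) auto
  ultimately have "?W A2 \<le> ?W {S. {..<t} \<subseteq> S \<and> S \<subseteq> {..<n} \<and> card S \<le> k}"
    by (intro sum_mono2) auto
  with max2[OF A] show ?thesis by linarith
qed

section \<open>From words to sets\<close>

definition weight_words :: "nat \<Rightarrow> nat \<Rightarrow> nat \<Rightarrow> nat list set" where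
  "weight_words q k n = {x \<in> words q n. wt x = k}"

definition ones :: "nat list \<Rightarrow> nat set" where
  "ones x = {i. i < length x \<and> x ! i = 1}"

definition agree :: "nat \<Rightarrow> nat list \<Rightarrow> nat list \<Rightarrow> nat set" where
  "agree n x y = {i. i < n \<and> x ! i = y ! i \<and> x ! i \<noteq> 0}"

definition to_one :: "nat \<Rightarrow> nat \<Rightarrow> nat list \<Rightarrow> nat list" where
  "to_one i c x = (if i < length x \<and> x ! i = c then x[i := 1] else x)"

lemma finite_weight_words: "finite (weight_words q k n)"
  using finite_words by (simp add: weight_words_def)

lemma wt_list_update: "x ! i \<noteq> 0 \<Longrightarrow> a \<noteq> 0 \<Longrightarrow> wt (x[i := a]) = wt x"
  unfolding wt_def
  by (cases "i < length x"; intro arg_cong[where f = card])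
    (auto simp: nth_list_update split: if_splits)

text \<open>
  Replacing \<open>c \<ge> 2\<close> by \<open>1\<close> at a position lowers the sum of the letters, which serves as
  potential, and keeps the support and so the weight.
\<close>

lemma exists_one_closed_family:
  assumes G: "intersecting_family q t k n G"
  obtains G' where "intersecting_family q t k n G'" "card G' = card G"
    "\<And>x i. x \<in> G' \<Longrightarrow> i < n \<Longrightarrow> 2 \<le> x ! i \<Longrightarrow> x[i := 1] \<in> G'"
proof -
  let ?U = "weight_words q k n"
  let ?F = "{to_one i c | i c. i < n \<and> 2 \<le> c}"
  have "\<exists>G'. finite G' \<and> G' \<subseteq> ?U \<and> (\<forall>x\<in>G'. \<forall>y\<in>G'. t \<le> card (agree n x y)) \<and>
      (\<Sum>x\<in>G'. 1) = (\<Sum>x\<in>G. 1 :: nat) \<and> (\<forall>f\<in>?F. \<forall>x\<in>G'. f x \<in> G')"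
  proof (rule exists_compressed_family[where h = sum_list and
        w = "\<lambda>_. 1" and I = "\<lambda>x y. card (agree n x y)"])
    show "finite G" using G by (rule finite_intersecting_family)
    show "G \<subseteq> ?U" "\<And>x y. x \<in> G \<Longrightarrow> y \<in> G \<Longrightarrow> t \<le> card (agree n x y)"
      using G by (auto simp: intersecting_family_def weight_words_def agree_def)
    fix f x assume f: "f \<in> ?F" and x: "x \<in> ?U"
    from f obtain i c where ic: "f = to_one i c" "i < n" "2 \<le> c" by blast
    have lx: "length x = n" using x by (simp add: weight_words_def words_def)
    have "1 < q" if "i < n" "x ! i = c"
    proof -
      have "x ! i \<in> set x" using that(1) lx by simp
      then show ?thesis using that(2) x ic(3) by (auto simp: weight_words_def words_def)
    qed
    then show "f x \<in> ?U"
      using x ic set_update_subset_insert[of x i 1]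
      by (auto simp: to_one_def weight_words_def words_def wt_list_update)
    show "sum_list (f x) < sum_list x" if "f x \<noteq> x"
    proof -
      have "x ! i = c" "f x = x[i := 1]" using that ic by (auto simp: to_one_def split: if_splits)
      moreover have "x ! i \<le> sum_list x" using lx ic(2) by (simp add: elem_le_sum_list)
      ultimately show ?thesis using lx ic by (simp add: sum_list_update)
    qed
    fix y assume y: "y \<in> ?U"
    have ly: "length y = n" using y by (simp add: weight_words_def words_def)
    show "x = y" if "f x \<noteq> x" "f y \<noteq> y" "f x = f y"
    proof -
      have "z = (f z)[i := c]" if "f z \<noteq> z" for z
      proof -
        have "z ! i = c" "f z = z[i := 1]"
          using that ic by (auto simp: to_one_def split: if_splits)
        then show ?thesis by (metis list_update_id list_update_overwrite)
      qed
      then have "x = (f x)[i := c]" "y = (f y)[i := c]" using that(1,2) by blast+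
      with that(3) show ?thesis by simp
    qed
    show "card (agree n x y) \<le> card (agree n (f x) (f y))"
      using ic lx ly
      by (intro card_mono) (auto simp: agree_def to_one_def nth_list_update)
    show "card (agree n x (f y)) \<le> card (agree n (f x) y)" if "f x \<noteq> x" "f y \<noteq> y"
      using that ic lx ly
      by (intro card_mono) (auto simp: agree_def to_one_def nth_list_update split: if_splits)
  qed (auto simp: agree_def intro: arg_cong[where f = card])
  then obtain G' where G': "G' \<subseteq> ?U" "\<forall>x\<in>G'. \<forall>y\<in>G'. t \<le> card (agree n x y)"
      "card G' = card G" "\<forall>f\<in>?F. \<forall>x\<in>G'. f x \<in> G'" by auto
  show ?thesis
  proof (rule that[OF _ G'(3)])
    show "intersecting_family q t k n G'"
      using G'(1,2) by (auto simp: intersecting_family_def weight_words_def agree_def)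
    fix x i assume *: "x \<in> G'" "i < n" "2 \<le> x ! i"
    have "length x = n" using *(1) G'(1) by (auto simp: weight_words_def words_def)
    moreover have "to_one i (x ! i) x \<in> G'" using G'(4) * by blast
    ultimately show "x[i := 1] \<in> G'" using *(2) by (simp add: to_one_def)
  qed
qed

text \<open>
  A common letter \<open>\<ge> 2\<close> can be turned into a one in \<open>x\<close> alone. This destroys one agreement with \<open>y\<close>,
  but leaves the common ones unchanged and the word in the family. Once no such letter is
  left, every remaining agreement is a common one.
\<close>

lemma ones_meet:
  assumes G: "intersecting_family q t k n G"
    and closed: "\<And>x i. x \<in> G \<Longrightarrow> i < n \<Longrightarrow> 2 \<le> x ! i \<Longrightarrow> x[i := 1] \<in> G"
    and "x \<in> G" "y \<in> G"
  shows "t \<le> card (ones x \<inter> ones y)"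
  using assms(3)
proof (induction "card (agree n x y - ones y)" arbitrary: x rule: less_induct)
  case less
  have len: "length x = n" "length y = n"
    using G less.prems assms(4) by (auto simp: intersecting_family_def words_def)
  have fin: "finite (agree n x y)" by (simp add: agree_def)
  show ?case
  proof (cases "agree n x y \<subseteq> ones y")
    case True
    then have "agree n x y = ones x \<inter> ones y"
      using len by (auto simp: agree_def ones_def)
    moreover have "t \<le> card (agree n x y)"
      using G less.prems assms(4) by (auto simp: intersecting_family_def agree_def)
    ultimately show ?thesis by simp
  next
    case False
    then obtain i where i: "i \<in> agree n x y" "i \<notin> ones y" by blast
    then have i': "i < n" "x ! i = y ! i" "2 \<le> x ! i"
      using len by (auto simp: agree_def ones_def)
    have "agree n (x[i := 1]) y - ones y = agree n x y - ones y - {i}"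
      using len i' by (auto simp: agree_def ones_def nth_list_update split: if_splits)
    then have "card (agree n (x[i := 1]) y - ones y) < card (agree n x y - ones y)"
      using i fin by (metis DiffI card_Diff1_less finite_Diff)
    moreover have "x[i := 1] \<in> G" using closed less.prems i' by blast
    ultimately have "t \<le> card (ones (x[i := 1]) \<inter> ones y)" by (rule less.hyps)
    also have "ones (x[i := 1]) \<inter> ones y = ones x \<inter> ones y"
      using len i' by (auto simp: ones_def nth_list_update split: if_splits)
    finally show ?thesis .
  qed
qed

lemma ones_subset: "x \<in> weight_words q k n \<Longrightarrow> ones x \<subseteq> {..<n} \<and> card (ones x) \<le> k"
  by (auto simp: weight_words_def words_def wt_def ones_def intro!: card_mono)

lemma card_words_with_letters:
  fixes P :: "nat \<Rightarrow> 'a set"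
  shows "card {x. length x = n \<and> (\<forall>i<n. x ! i \<in> P i)} = (\<Prod>i<n. card (P i))"
proof (induction n)
  case (Suc n)
  let ?X = "{x. length x = n \<and> (\<forall>i<n. x ! i \<in> P i)}"
  have "{x. length x = Suc n \<and> (\<forall>i<Suc n. x ! i \<in> P i)} = (\<lambda>(x, a). x @ [a]) ` (?X \<times> P n)"
    (is "?L = ?R")
  proof
    show "?L \<subseteq> ?R"
    proof
      fix x assume x: "x \<in> ?L"
      then have "x = butlast x @ [x ! n]"
        by (metis (mono_tags) append_butlast_last_id diff_Suc_1 last_conv_nth length_0_conv
            mem_Collect_eq nat.distinct(1))
      moreover have "butlast x \<in> ?X" "x ! n \<in> P n"
        using x by (auto simp: nth_butlast)
      ultimately show "x \<in> ?R" by (auto intro!: image_eqI[of _ _ "(butlast x, x ! n)"])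
    qed
  qed (auto simp: nth_append less_Suc_eq)
  moreover have "inj_on (\<lambda>(x, a). x @ [a]) (?X \<times> P n)"
    by (auto simp: inj_on_def)
  ultimately show ?case
    using Suc by (simp add: card_image card_cartesian_product)
qed simp

text \<open>
  Choose the set \<open>K\<close> of positions of the remaining \<open>k - card S\<close> nonzero letters, and fill each
  of them with one of the \<open>q - 2\<close> letters \<open>\<ge> 2\<close>.
\<close>

lemma card_fixed_ones:
  assumes S: "S \<subseteq> {..<n}" "card S \<le> k" and q: "2 < q"
  shows "card {x \<in> weight_words q k n. ones x = S} =
    (n - card S choose (k - card S)) * (q - 2) ^ (k - card S)"
proof -
  let ?K = "{K. K \<subseteq> {..<n} - S \<and> card K = k - card S}"
  define X where "X K = {x. length x = n \<and> (\<forall>i<n. x ! i \<in>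
    (if i \<in> S then {1} else if i \<in> K then {2..<q} else {0}))}" for K
  have finS: "finite S" using S finite_subset by blast
  have finK: "finite ?K" by simp
  have card_X: "card (X K) = (q - 2) ^ (k - card S)" if "K \<in> ?K" for K
  proof -
    have "card (X K) = (\<Prod>i<n. if i \<in> K then q - 2 else 1)"
      unfolding X_def card_words_with_letters using that by (intro prod.cong) auto
    also have "\<dots> = (\<Prod>i\<in>{i \<in> {..<n}. i \<in> K}. q - 2)"
      by (rule prod.inter_filter[symmetric]) simp
    also have "{i \<in> {..<n}. i \<in> K} = K" using that by auto
    finally show ?thesis using that by simp
  qed
  have large: "K = {i. i < n \<and> 2 \<le> x ! i}" if "K \<in> ?K" "x \<in> X K" for K x
    using that by (auto simp: X_def split: if_splits)
  have wt_split: "wt x = card S + card {i. i < n \<and> 2 \<le> x ! i}"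
    if "length x = n" "ones x = S" for x
  proof -
    have "{i. i < length x \<and> x ! i \<noteq> 0} = S \<union> {i. i < n \<and> 2 \<le> x ! i}"
      using that by (auto simp: ones_def)
    moreover have "S \<inter> {i. i < n \<and> 2 \<le> x ! i} = {}" using that by (auto simp: ones_def)
    ultimately show ?thesis using finS by (simp add: wt_def card_Un_disjoint)
  qed
  have "{x \<in> weight_words q k n. ones x = S} = (\<Union>K\<in>?K. X K)"
  proof (intro equalityI subsetI)
    fix x assume x: "x \<in> {x \<in> weight_words q k n. ones x = S}"
    define K where "K = {i. i < n \<and> 2 \<le> x ! i}"
    have len: "length x = n" and letters: "set x \<subseteq> {0..<q}" and "wt x = k" and on: "ones x = S"
      using x by (auto simp: weight_words_def words_def)
    then have "K \<in> ?K" using wt_split[of x] by (auto simp: K_def ones_def)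
    moreover have "x ! i \<in> (if i \<in> S then {1} else if i \<in> K then {2..<q} else {0})"
      if "i < n" for i
    proof -
      have "x ! i < q" using that len letters by (metis atLeastLessThan_iff nth_mem subsetD)
      moreover have "i \<in> S \<longleftrightarrow> x ! i = 1" using that len by (simp add: on[symmetric] ones_def)
      ultimately show ?thesis using that by (auto simp: K_def)
    qed
    then have "x \<in> X K" using len by (simp add: X_def)
    ultimately show "x \<in> (\<Union>K\<in>?K. X K)" by (rule UN_I)
  next
    fix x assume "x \<in> (\<Union>K\<in>?K. X K)"
    then obtain K where K: "K \<in> ?K" "x \<in> X K" by blast
    have letter: "x ! i \<in> (if i \<in> S then {1} else if i \<in> K then {2..<q} else {0})" if "i < n" for i
      using K(2) that by (auto simp: X_def)
    have len: "length x = n" using K(2) by (simp add: X_def)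
    have on: "ones x = S"
    proof -
      have "x ! i = 1 \<longleftrightarrow> i \<in> S" if "i < n" for i
        using letter[OF that] by (auto split: if_splits)
      then show ?thesis using S(1) len by (auto simp: ones_def)
    qed
    have "x ! i < q" if "i < n" for i
      using letter[OF that] q by (auto split: if_splits)
    then have "x \<in> words q n" using len by (auto simp: words_def in_set_conv_nth)
    moreover have "wt x = k"
      using wt_split[OF len on] large[OF K] K(1) S(2) by auto
    ultimately show "x \<in> {x \<in> weight_words q k n. ones x = S}"
      using on by (simp add: weight_words_def)
  qed
  moreover have "card (\<Union>K\<in>?K. X K) = (\<Sum>K\<in>?K. card (X K))"
  proof (rule card_UN_disjoint[OF finK])
    show "\<forall>K\<in>?K. finite (X K)"
      using card_X q
      by (metis (no_types, lifting) card.infinite nat_less_le power_not_zero zero_less_diff)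
    show "\<forall>K\<in>?K. \<forall>L\<in>?K. K \<noteq> L \<longrightarrow> X K \<inter> X L = {}"
      using large by blast
  qed
  ultimately have "card {x \<in> weight_words q k n. ones x = S} = card ?K * (q - 2) ^ (k - card S)"
    by (simp add: card_X)
  moreover have "card ?K = n - card S choose (k - card S)"
    using S finS by (simp add: n_subsets card_Diff_subset)
  ultimately show ?thesis by simp
qed

lemma card_words_by_ones:
  assumes "finite A"
  shows "card {x \<in> weight_words q k n. ones x \<in> A} =
    (\<Sum>S\<in>A. card {x \<in> weight_words q k n. ones x = S})"
proof -
  have "{x \<in> weight_words q k n. ones x \<in> A} =
      (\<Union>S\<in>A. {x \<in> weight_words q k n. ones x = S})" by blast
  also have "card \<dots> = (\<Sum>S\<in>A. card {x \<in> weight_words q k n. ones x = S})"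
    using assms finite_weight_words by (intro card_UN_disjoint) auto
  finally show ?thesis .
qed

text \<open>
  The absorption identity gives \<open>(k - s) * w s = (n - s) * (q - 2) * w (Suc s)\<close>, and
  the lower bound on \<open>n\<close> yields \<open>(t + 1) * (k - s) < n - s\<close> for every \<open>s \<ge> t\<close>. In the proof
  \<open>k - s\<close> is \<open>Suc r\<close> and \<open>n - s\<close> is \<open>Suc v\<close>, which avoids truncated subtraction.
\<close>

lemma fixed_ones_decay:
  fixes k n q t :: nat
  defines "w \<equiv> \<lambda>s. (n - s choose (k - s)) * (q - 2) ^ (k - s)"
  assumes "2 < q" "k \<le> n" "(t + 1) * (k - t + 1) \<le> n" "t \<le> s" "s < k"
  shows "(t + 1) * w (Suc s) < w s"
proof -
  obtain r where r: "k = s + Suc r" using \<open>s < k\<close> less_iff_Suc_add by auto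
  obtain u where u: "s = t + u" using \<open>t \<le> s\<close> le_Suc_ex by blast
  obtain v where v: "n = s + Suc v"
    using \<open>s < k\<close> \<open>k \<le> n\<close> by (metis less_le_trans less_iff_Suc_add add_Suc_right)
  have "r \<le> v" using \<open>k \<le> n\<close> r v by simp
  then have pos: "0 < w (Suc s)" using \<open>2 < q\<close> r v by (simp add: w_def)
  have "(t + 1) * Suc r < Suc v"
    using assms(4) r u v by (simp add: algebra_simps)
  then have "((t + 1) * Suc r) * w (Suc s) < Suc v * w (Suc s)"
    using pos by (rule mult_strict_right_mono)
  also have "\<dots> \<le> (q - 2) * (Suc v * w (Suc s))"
    using \<open>2 < q\<close> mult_le_mono1[of 1 "q - 2"] by (simp only: mult_1)
  also have "\<dots> = (q - 2) ^ Suc r * (Suc v * (v choose r))"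
    using r v by (simp add: w_def ac_simps del: mult_Suc mult_Suc_right)
  also have "\<dots> = Suc r * w s"
    unfolding Suc_times_binomial_eq using r v
    by (simp add: w_def ac_simps del: binomial_Suc_Suc mult_Suc mult_Suc_right)
  finally have "Suc r * ((t + 1) * w (Suc s)) < Suc r * w s" by (simp only: ac_simps)
  then show ?thesis unfolding mult_less_cancel1 by blast
qed

lemma star_family_eq:
  assumes "t \<le> k" "k \<le> n" "1 < q"
  shows "star_family q t k n = {x \<in> weight_words q k n. {..<t} \<subseteq> ones x}"
proof -
  have wt_app: "wt (replicate t 1 @ b) = t + wt b" for b
  proof -
    have "{i. i < length (replicate t 1 @ b) \<and> (replicate t 1 @ b) ! i \<noteq> 0} =
        {..<t} \<union> (+) t ` {i. i < length b \<and> b ! i \<noteq> 0}" (is "?L = ?R")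
    proof
      show "?L \<subseteq> ?R"
      proof
        fix i assume "i \<in> ?L"
        then show "i \<in> ?R"
          by (cases "i < t") (auto simp: nth_append image_iff intro!: exI[of _ "i - t"])
      qed
    qed (auto simp: nth_append)
    moreover have "card ?R = t + wt b"
      unfolding wt_def by (subst card_Un_disjoint) (auto simp: card_image)
    ultimately show ?thesis by (simp add: wt_def)
  qed
  show ?thesis
  proof (intro equalityI subsetI)
    fix x assume "x \<in> star_family q t k n"
    then obtain b where "x = replicate t 1 @ b" "b \<in> words q (n - t)" "wt b = k - t"
      by (auto simp: star_family_def)
    then show "x \<in> {x \<in> weight_words q k n. {..<t} \<subseteq> ones x}"
      using assms wt_app[of b]
      by (auto simp: weight_words_def words_def ones_def nth_append)
  next
    fix x assume x: "x \<in> {x \<in> weight_words q k n. {..<t} \<subseteq> ones x}"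
    then have len: "length x = n" by (simp add: weight_words_def words_def)
    have "take t x = replicate t 1"
      using x len assms by (intro nth_equalityI) (auto simp: ones_def)
    then have split: "x = replicate t 1 @ drop t x"
      by (metis append_take_drop_id)
    have "drop t x \<in> words q (n - t)"
      using x len set_drop_subset[of t x] by (auto simp: weight_words_def words_def)
    moreover have "wt (drop t x) = k - t"
      using x split wt_app[of "drop t x"] by (simp add: weight_words_def)
    ultimately show "x \<in> star_family q t k n"
      unfolding star_family_def using split by blast
  qed
qed

theorem theorem5:
  fixes n k t q :: nat
  assumes "q > 2"
    and "n \<ge> k" and "k > t" and "t \<ge> 0"
    and "n \<ge> (t + 1) * (k - t + 1)"
    and "q \<ge> t + 1"
  shows "intersecting_family q t k n (star_family q t k n) \<and>
    (\<forall>G. intersecting_family q t k n G \<longrightarrow> card G \<le> card (star_family q t k n))"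
proof (intro conjI allI impI)
  let ?V = "weight_words q k n"
  have star: "star_family q t k n = {x \<in> ?V. {..<t} \<subseteq> ones x}"
    using assms by (intro star_family_eq) auto
  show "intersecting_family q t k n (star_family q t k n)"
    unfolding intersecting_family_def
  proof (intro conjI ballI)
    show "star_family q t k n \<subseteq> {x \<in> words q n. wt x = k}"
      by (auto simp: star weight_words_def)
    fix x y assume "x \<in> star_family q t k n" "y \<in> star_family q t k n"
    then have "{..<t} \<subseteq> {i. i < n \<and> x ! i = y ! i \<and> x ! i \<noteq> 0}"
      by (fastforce simp: star weight_words_def words_def ones_def)
    then have "card {..<t} \<le> card {i. i < n \<and> x ! i = y ! i \<and> x ! i \<noteq> 0}"
      by (intro card_mono) auto
    then show "t \<le> card {i. i < n \<and> x ! i = y ! i \<and> x ! i \<noteq> 0}" by simp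
  qed
  fix G assume "intersecting_family q t k n G"
  then obtain G' where G': "intersecting_family q t k n G'" and card_G': "card G' = card G"
    and closed: "\<And>x i. x \<in> G' \<Longrightarrow> i < n \<Longrightarrow> 2 \<le> x ! i \<Longrightarrow> x[i := 1] \<in> G'"
    using exists_one_closed_family by blast
  define w where "w s = (n - s choose (k - s)) * (q - 2) ^ (k - s)" for s
  have w: "card {x \<in> ?V. ones x = S} = w (card S)" if "S \<subseteq> {..<n}" "card S \<le> k" for S
    using card_fixed_ones[OF that \<open>q > 2\<close>] by (simp add: w_def)
  have G'V: "G' \<subseteq> ?V" using G' by (simp add: intersecting_family_def weight_words_def)
  let ?A = "ones ` G'" and ?S = "{S. {..<t} \<subseteq> S \<and> S \<subseteq> {..<n} \<and> card S \<le> k}"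
  have A: "intersecting_sets t k n ?A"
    unfolding intersecting_sets_def
    using G'V ones_subset[of _ q k n] ones_meet[OF G' closed] by auto
  have "card G \<le> card {x \<in> ?V. ones x \<in> ?A}"
    unfolding card_G'[symmetric] using G'V finite_weight_words by (intro card_mono) auto
  also have "\<dots> = (\<Sum>S\<in>?A. w (card S))"
    using A intersecting_sets_finite[OF A] unfolding intersecting_sets_def
    by (subst card_words_by_ones) (auto simp: w intro!: sum.cong)
  also have "\<dots> \<le> (\<Sum>S\<in>?S. w (card S))"
  proof (rule weighted_intersection_bound[OF _ A])
    show "(t + 1) * w (Suc s) < w s" if "t \<le> s" "s < k" for s
      unfolding w_def using assms that by (intro fixed_ones_decay) auto
  qed
  also have "\<dots> = card {x \<in> ?V. ones x \<in> ?S}"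
    by (subst card_words_by_ones) (auto simp: w intro!: sum.cong finite_subset[of ?S "Pow {..<n}"])
  also have "{x \<in> ?V. ones x \<in> ?S} = star_family q t k n"
    unfolding star using ones_subset by blast
  finally show "card G \<le> card (star_family q t k n)" .
qed

end
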